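(* Let $s\ge 1$ be an integer and let $C_{2s+1}$ be the cycle on $2s+1$ vertices. Let $\mathcal{I}=(I_1,I_2,\ldots,I_s)$ be a family of $s$ (not necessarily distinct) independent sets of $C_{2s+1}$, each of size $s$. Then there is a rainbow independent set of size $s$ for $\mathcal{I}$ in $C_{2s+1}$, i.e. there exist pairwise distinct vertices $x_1\in I_1,\, x_2\in I_2,\ldots,\, x_s\in I_s$ such that $\{x_1,\ldots,x_s\}$ is an independent set of $C_{2s+1}$. Consequently, $f_{C_{2s+1}}(s,s)=s$.
   Context: A set of vertices of a graph is independent if it contains no edge; an $n$-set is a set of size $n$. For a family $\mathcal{F}=(F_1,\ldots,F_m)$ of (not necessarily distinct) sets, a (partial) rainbow set for $\mathcal{F}$ is a set $R=\{x_{i_1},\ldots,x_{i_k}\}$ with $1\le i_1<\cdots<i_k\le m$, $x_{i_j}\in F_{i_j}$ for all $j$, and the elements $x_{i_j}$ pairwise distinct; a rainbow independent set is a rainbow set that is independent. For a graph $G$ and integers $m\le n$, $f_G(n,m)$ denotes the minimal number $k$ such that every family of $k$ independent $n$-sets in $G$ has a (partial) rainbow independent $m$-set. *)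

theory Defs
  imports Main "HOL-Library.Extended_Nat"
begin

record 'v graph =
  verts :: "'v set"
  edges :: "'v set set"

definition simple_graph :: "'v graph \<Rightarrow> bool" where
  "simple_graph G \<longleftrightarrow> (\<forall>e\<in>edges G. e \<subseteq> verts G \<and> card e = 2)"

definition independent_set :: "'v graph \<Rightarrow> 'v set \<Rightarrow> bool" where
  "independent_set G S \<longleftrightarrow> S \<subseteq> verts G \<and> (\<forall>e\<in>edges G. \<not> e \<subseteq> S)"

text \<open>This is the usual cycle only for \<open>n \<ge> 3\<close>.\<close>

definition cycle_graph :: "nat \<Rightarrow> nat graph" where
  "cycle_graph n = \<lparr>verts = {..<n}, edges = {{i, Suc i mod n} | i. i < n}\<rparr>"

text \<open>A family \<open>(F\<^sub>1, \<dots>, F\<^sub>m)\<close> of not necessarily distinct sets is a function \<open>F\<close> together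
  with its length \<open>m\<close>; values of \<open>F\<close> outside \<open>{1..m}\<close> are irrelevant. The set \<open>J\<close> below
  collects the indices \<open>i\<^sub>1 < \<dots> < i\<^sub>k\<close> that are represented.\<close>

definition rainbow_set :: "nat \<Rightarrow> (nat \<Rightarrow> 'v set) \<Rightarrow> 'v set \<Rightarrow> bool" where
  "rainbow_set m F R \<longleftrightarrow>
     (\<exists>J x. J \<subseteq> {1..m} \<and> (\<forall>j\<in>J. x j \<in> F j) \<and> inj_on x J \<and> R = x ` J)"

definition independent_family :: "'v graph \<Rightarrow> nat \<Rightarrow> nat \<Rightarrow> (nat \<Rightarrow> 'v set) \<Rightarrow> bool" where
  "independent_family G n k F \<longleftrightarrow>
     (\<forall>i\<in>{1..k}. independent_set G (F i) \<and> finite (F i) \<and> card (F i) = n)"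

text \<open>The minimum is taken in \<open>enat\<close>, so that it is \<open>\<infinity>\<close> if no \<open>k\<close> has the property.\<close>

definition rainbow_number :: "'v graph \<Rightarrow> nat \<Rightarrow> nat \<Rightarrow> enat" where
  "rainbow_number G n m =
     Inf (enat ` {k. \<forall>F. independent_family G n k F \<longrightarrow>
                    (\<exists>R. rainbow_set k F R \<and> independent_set G R \<and> card R = m)})"

lemma finite_rainbow_set: "rainbow_set m F R \<Longrightarrow> finite R"
  unfolding rainbow_set_def by (meson finite_atLeastAtMost finite_imageI finite_subset)

lemma simple_graph_cycle_graph:
  assumes "n \<ge> 3"
  shows "simple_graph (cycle_graph n)"
proof -
  have "i \<noteq> Suc i mod n" if "i < n" for i
    using assms that by (cases "Suc i = n") auto
  then show ?thesis
    using assms by (auto simp: simple_graph_def cycle_graph_def card_2_iff)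
qed

end

theory Submission
  imports Defs
begin

text \<open>
  Multiplication by \<open>2\<close> is invertible modulo \<open>N = 2s + 1\<close>, and after relabelling the vertices as
  \<open>2z mod N\<close> the independent \<open>s\<close>-sets of the cycle become the cyclic intervals of length \<open>s\<close>. Let
  \<open>a\<^sub>i\<close> be the starting points of the given intervals and let \<open>W\<close> be the walk on the integers with
  increments \<open>W x - W (x - 1) = 1 - |{i. a\<^sub>i \<equiv> x (mod N)}|\<close>. It gains \<open>s + 1\<close> per period and climbs
  by at most \<open>1\<close>, so it has a last visit to every level and a first visit to every level; each of the
  two kinds of times occupies at least \<open>s + 1\<close> residues modulo \<open>N\<close>. As \<open>2 (s + 1) > N\<close>, some time \<open>c\<close>
  is of both kinds. The given intervals meet the target interval \<open>{c - s..<c}\<close> in prefixes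
  and suffixes, and the two properties of \<open>c\<close> say exactly that, for every \<open>k\<close>, at most \<open>k\<close> of the
  prefixes (suffixes) have length at most \<open>k\<close>, so that prefixes can be served greedily from
  the left and suffixes from the right.
\<close>

section \<open>Walks with upward steps at most one\<close>

lemma quasiperiodic_shift:
  fixes W :: "int \<Rightarrow> int"
  assumes per: "\<And>x. W (x + N) = W x + M"
  shows "W (x + N * k) = W x + M * k"
proof (induction k rule: int_induct[where k = 0])
  case (step1 i)
  then show ?case using per[of "x + N * i"] by (simp add: algebra_simps)
next
  case (step2 i)
  then show ?case using per[of "x + N * (i - 1)"] by (simp add: algebra_simps)
qed simp

text \<open>Positive gain per period drives \<open>W\<close> below \<open>v\<close> on the left and
  above \<open>v\<close> on the right, so the times with value at most \<open>v\<close> have a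
  maximum. The next value exceeds \<open>v\<close> and a step climbs at most 1, so the value at the
  maximum is exactly \<open>v\<close>.\<close>

lemma last_visit_exists:
  fixes W :: "int \<Rightarrow> int"
  assumes "N > 0" "M > 0" and per: "\<And>x. W (x + N) = W x + M" and up: "\<And>x. W (x + 1) \<le> W x + 1"
  obtains c where "W c = v" "\<And>y. y > c \<Longrightarrow> W y > v"
proof -
  note shift = quasiperiodic_shift[of W N M, OF per]
  define m where "m = Min (W ` {0..<N})"
  \<comment> \<open>As \<open>M\<close> is at least 1, going back this many periods from 0 brings
    the walk down to \<open>v\<close> or lower.\<close>
  define x0 where "x0 = N * (- \<bar>W 0 - v\<bar>)"
  have "W x0 = W 0 - M * \<bar>W 0 - v\<bar>"
    using shift[of 0 "- \<bar>W 0 - v\<bar>"] by (simp add: x0_def)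
  moreover have "M * \<bar>W 0 - v\<bar> \<ge> 1 * \<bar>W 0 - v\<bar>"
    using \<open>M > 0\<close> by (intro mult_right_mono) auto
  moreover have "W 0 - v \<le> \<bar>W 0 - v\<bar>" by simp
  ultimately have x0: "W x0 \<le> v" by (smt (verit) mult_1)
  have bound: "x < N * (\<bar>v - m\<bar> + 1)" if "W x \<le> v" for x
  proof -
    have "m \<le> W (x mod N)"
      unfolding m_def using \<open>N > 0\<close> by (intro Min_le) auto
    moreover have "W x = W (x mod N) + M * (x div N)"
      using shift[of "x mod N" "x div N"] by (simp add: algebra_simps)
    ultimately have le: "M * (x div N) \<le> v - m" using that by linarith
    have "x div N \<le> \<bar>v - m\<bar>"
    proof (cases "x div N \<ge> 0")
      case True
      then have "1 * (x div N) \<le> M * (x div N)" using \<open>M > 0\<close> by (intro mult_right_mono) auto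
      then show ?thesis using le by linarith
    qed linarith
    then have "N * (x div N) \<le> N * \<bar>v - m\<bar>" using \<open>N > 0\<close> by simp
    moreover have "x = N * (x div N) + x mod N" by (rule mult_div_mod_eq[symmetric])
    moreover have "x mod N < N" using \<open>N > 0\<close> by simp
    ultimately have "x < N * \<bar>v - m\<bar> + N" by linarith
    then show ?thesis by (simp add: algebra_simps)
  qed
  define S where "S = {x. x0 \<le> x \<and> W x \<le> v}"
  have "S \<subseteq> {x0..N * (\<bar>v - m\<bar> + 1)}" using bound by (fastforce simp: S_def)
  then have fin: "finite S" by (rule finite_subset) simp
  have "S \<noteq> {}" using x0 by (auto simp: S_def)
  define c where "c = Max S"
  have cS: "x0 \<le> c" "W c \<le> v"
    using Max_in[OF fin \<open>S \<noteq> {}\<close>] by (auto simp: c_def S_def)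
  have later: "W y > v" if "y > c" for y
  proof (rule ccontr)
    assume "\<not> W y > v"
    then have "y \<in> S" using that cS by (auto simp: S_def)
    then show False using Max_ge[OF fin] that by (fastforce simp: c_def)
  qed
  have "W c = v" using later[of "c + 1"] up[of c] cS by linarith
  then show thesis using later that by blast
qed

text \<open>Shifting a last visit by whole periods into \<open>{0..<N}\<close> gives a last visit
  again and changes its level by a multiple of \<open>M\<close>. The \<open>M\<close> residues of
  levels therefore need \<open>M\<close> different times.\<close>

lemma card_last_visits:
  fixes W :: "int \<Rightarrow> int"
  assumes "N > 0" "M > 0" and per: "\<And>x. W (x + N) = W x + M" and up: "\<And>x. W (x + 1) \<le> W x + 1"
  shows "int (card {c \<in> {0..<N}. \<forall>y>c. W y > W c}) \<ge> M"
proof -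
  let ?R = "{c \<in> {0..<N}. \<forall>y>c. W y > W c}"
  note shift = quasiperiodic_shift[of W N M, OF per]
  have "{0..<M} \<subseteq> (\<lambda>c. W c mod M) ` ?R"
  proof
    fix v assume v: "v \<in> {0..<M}"
    obtain c where c: "W c = v" "\<And>y. y > c \<Longrightarrow> W y > v"
      using last_visit_exists[OF assms] by blast
    have "W (c mod N) = v - M * (c div N)"
      using shift[of "c mod N" "c div N"] c by (simp add: algebra_simps)
    moreover have "W y > v - M * (c div N)" if "y > c mod N" for y
    proof -
      have "y + N * (c div N) > c" using that by (metis add_less_cancel_right mod_mult_div_eq)
      then show ?thesis using c(2)[of "y + N * (c div N)"] shift[of y "c div N"] by simp
    qed
    moreover have "(v - M * (c div N)) mod M = v" using v by (simp add: mod_diff_eq[symmetric])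
    ultimately show "v \<in> (\<lambda>c. W c mod M) ` ?R"
      using \<open>N > 0\<close> by (intro image_eqI[of _ _ "c mod N"]) auto
  qed
  then have "card {0..<M} \<le> card ?R" by (intro surj_card_le finite_subset[of ?R "{0..<N}"]) auto
  then show ?thesis by simp
qed

lemma renewal_time_exists:
  fixes W :: "int \<Rightarrow> int"
  assumes "N > 0" "2 * M > N" and per: "\<And>x. W (x + N) = W x + M" and up: "\<And>x. W (x + 1) \<le> W x + 1"
  obtains c where "\<And>y. y > c \<Longrightarrow> W y > W c" "\<And>y. y < c \<Longrightarrow> W y < W c"
proof -
  have "M > 0" using assms by linarith
  let ?R = "{c \<in> {0..<N}. \<forall>y>c. W y > W c}"
  let ?L = "{c \<in> {0..<N}. \<forall>y<c. W y < W c}"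
  \<comment> \<open>The time-reversed walk, shifted so that \<open>{0..<N}\<close> is mapped to itself.\<close>
  define V where "V x = - W (N - 1 - x)" for x
  have "V (x + N) = V x + M" for x
    using per[of "N - 1 - x - N"] by (simp add: V_def algebra_simps)
  moreover have "V (x + 1) \<le> V x + 1" for x
    using up[of "N - 1 - x - 1"] by (simp add: V_def algebra_simps)
  ultimately have "int (card {c \<in> {0..<N}. \<forall>y>c. V y > V c}) \<ge> M"
    using \<open>N > 0\<close> \<open>M > 0\<close> by (intro card_last_visits) auto
  moreover have "card {c \<in> {0..<N}. \<forall>y>c. V y > V c} \<le> card ?L"
  proof (rule card_inj_on_le[of "\<lambda>x. N - 1 - x"])
    show "(\<lambda>x. N - 1 - x) ` {c \<in> {0..<N}. \<forall>y>c. V y > V c} \<subseteq> ?L"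
    proof clarsimp
      fix c y :: int
      assume "\<forall>y>c. V c < V y" "y < N - 1 - c"
      then have "V c < V (N - 1 - y)" by auto
      then show "W y < W (N - 1 - c)" by (simp add: V_def)
    qed
    show "finite ?L" by (rule finite_subset[of _ "{0..<N}"]) auto
  qed (auto simp: inj_on_def)
  moreover have "int (card ?R) \<ge> M"
    by (rule card_last_visits[OF \<open>N > 0\<close> \<open>M > 0\<close> per up])
  ultimately have "int (card ?R + card ?L) > N" using \<open>2 * M > N\<close> by linarith
  moreover have "card (?R \<union> ?L) \<le> card {0..<N}" by (intro card_mono) auto
  moreover have "card ?R + card ?L = card (?R \<union> ?L) + card (?R \<inter> ?L)"
    by (intro card_Un_Int; rule finite_subset[of _ "{0..<N}"]) auto
  ultimately have "card (?R \<inter> ?L) > 0" using \<open>N > 0\<close> by simp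
  then obtain c where "c \<in> ?R \<inter> ?L" unfolding card_gt_0_iff by blast
  then show thesis using that by auto
qed

section \<open>Matching into an interval\<close>

text \<open>Hall's condition for nested sets. The member with the largest bound takes the last
  position, and induction serves the others below it.\<close>

lemma greedy_matching:
  fixes l :: "'a \<Rightarrow> int"
  assumes "finite P" "\<And>k. k \<ge> 0 \<Longrightarrow> int (card {i \<in> P. l i \<le> k}) \<le> k"
  shows "\<exists>x. inj_on x P \<and> x ` P \<subseteq> {0..<int (card P)} \<and> (\<forall>i\<in>P. x i < l i)"
  using assms
proof (induction "card P" arbitrary: P)
  case 0
  then show ?case by auto
next
  case (Suc n)
  then have "Max (l ` P) \<in> l ` P" by (intro Max_in) auto
  then obtain j where j: "j \<in> P" "l j = Max (l ` P)" by auto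
  then have j: "j \<in> P" "\<And>i. i \<in> P \<Longrightarrow> l i \<le> l j" using Suc.prems(1) by auto
  \<comment> \<open>Otherwise all \<open>card P\<close> members would have bound at most
    \<open>card P - 1\<close>, against the hypothesis for that \<open>k\<close>.\<close>
  have lj: "l j \<ge> int (card P)"
  proof (rule ccontr)
    assume "\<not> ?thesis"
    then have "{i \<in> P. l i \<le> int n} = P" using j(2) Suc.hyps(2) by force
    then show False using Suc.prems(2)[of "int n"] Suc.hyps(2) by simp
  qed
  have "int (card {i \<in> P - {j}. l i \<le> k}) \<le> k" if "k \<ge> 0" for k
  proof -
    have "card {i \<in> P - {j}. l i \<le> k} \<le> card {i \<in> P. l i \<le> k}"
      using Suc.prems(1) by (intro card_mono) auto
    then show ?thesis using Suc.prems(2)[OF that] by linarith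
  qed
  moreover have n: "n = card (P - {j})" using Suc.hyps(2) j(1) Suc.prems(1) by simp
  ultimately obtain x where x: "inj_on x (P - {j})" "x ` (P - {j}) \<subseteq> {0..<int n}"
      "\<forall>i\<in>P - {j}. x i < l i"
    using Suc.hyps(1)[of "P - {j}"] Suc.prems(1) by auto
  have "inj_on (x(j := int n)) P"
  proof -
    have "inj_on (x(j := int n)) (insert j (P - {j}))"
      using x(1,2) by (fastforce simp: inj_on_def image_subset_iff)
    then show ?thesis using j(1) by (simp add: insert_absorb)
  qed
  moreover have "(x(j := int n)) ` P \<subseteq> {0..<int (card P)}"
  proof clarify
    fix i assume "i \<in> P"
    then have "i \<noteq> j \<Longrightarrow> 0 \<le> x i \<and> x i < int n" using x(2) by (auto simp: image_subset_iff)
    then show "(x(j := int n)) i \<in> {0..<int (card P)}" using Suc.hyps(2) by auto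
  qed
  moreover have "\<forall>i\<in>P. (x(j := int n)) i < l i" using x(3) lj Suc.hyps(2) by auto
  ultimately show ?case by blast
qed

text \<open>\<open>P\<close> fills the first \<open>card P\<close> positions and \<open>Q\<close>,
  by reflection, the last \<open>card Q\<close>; since \<open>n\<close> is the sum of the two, they
  do not collide.\<close>

lemma prefix_suffix_matching:
  fixes l r :: "'a \<Rightarrow> int"
  assumes "finite P" "finite Q" "P \<inter> Q = {}" and n: "n = int (card P + card Q)"
    and l: "\<And>k. k \<ge> 0 \<Longrightarrow> int (card {i \<in> P. l i \<le> k}) \<le> k"
    and r: "\<And>k. k \<ge> 0 \<Longrightarrow> int (card {i \<in> Q. r i \<le> k}) \<le> k"
  obtains x where "inj_on x (P \<union> Q)" "x ` (P \<union> Q) \<subseteq> {0..<n}"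
    "\<And>i. i \<in> P \<Longrightarrow> x i < l i" "\<And>i. i \<in> Q \<Longrightarrow> n - r i \<le> x i"
proof -
  obtain y where y: "inj_on y P" "y ` P \<subseteq> {0..<int (card P)}" "\<forall>i\<in>P. y i < l i"
    using greedy_matching[OF \<open>finite P\<close> l] by blast
  obtain z where z: "inj_on z Q" "z ` Q \<subseteq> {0..<int (card Q)}" "\<forall>i\<in>Q. z i < r i"
    using greedy_matching[OF \<open>finite Q\<close> r] by blast
  define x where "x i = (if i \<in> P then y i else n - 1 - z i)" for i
  have xP: "x i = y i" "0 \<le> x i" "x i < int (card P)" if "i \<in> P" for i
    using y(2) that by (auto simp: x_def image_subset_iff)
  have xQ: "x i = n - 1 - z i" "int (card P) \<le> x i" "x i < n" if "i \<in> Q" for i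
    using z(2) that n \<open>P \<inter> Q = {}\<close> by (force simp: x_def image_subset_iff)+
  have "inj_on x P" using y(1) xP(1) by (simp add: inj_on_def)
  moreover have "inj_on x Q" using z(1) xQ(1) by (simp add: inj_on_def)
  moreover have "x i \<noteq> x j" if "i \<in> P" "j \<in> Q" for i j
    using xP(3)[OF that(1)] xQ(2)[OF that(2)] by linarith
  ultimately have "inj_on x (P \<union> Q)"
    unfolding inj_on_def by (metis UnE)
  moreover have "x ` (P \<union> Q) \<subseteq> {0..<n}"
    using xP xQ n by (fastforce simp: image_subset_iff)
  moreover have "x i < l i" if "i \<in> P" for i using y(3) xP(1) that by simp
  moreover have "n - r i \<le> x i" if "i \<in> Q" for i using z(3) xQ(1)[OF that] that by force
  ultimately show thesis using that by blast
qed

section \<open>Systems of representatives of cyclic intervals\<close>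

lemma cyclic_intervals_matching:
  fixes a :: "'i \<Rightarrow> int"
  assumes "finite A" and s: "s = int (card A)" and N: "N = 2 * s + 1"
  obtains b x where "inj_on x A" "x ` A \<subseteq> {b..<b + s}"
    "\<And>i. i \<in> A \<Longrightarrow> \<exists>z\<in>{a i..<a i + s}. x i mod N = z mod N"
proof -
  have "N > 0" using s N by simp
  \<comment> \<open>Each quotient jumps by 1 exactly when \<open>x\<close> reaches a residue of
    \<open>a i\<close>, which gives a closed form of the walk with the required increments.\<close>
  define W where "W x = x - (\<Sum>i\<in>A. (x - a i) div N)" for x
  have "W (x + N) = W x + (s + 1)" for x
  proof -
    have "(x + N - a i) div N = (x - a i) div N + 1" for i
      using \<open>N > 0\<close> div_add_self2[of N "x - a i"] by (simp add: algebra_simps)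
    then show ?thesis using s N by (simp add: W_def sum.distrib)
  qed
  moreover have "W (x + 1) \<le> W x + 1" for x
  proof -
    have "(\<Sum>i\<in>A. (x - a i) div N) \<le> (\<Sum>i\<in>A. (x + 1 - a i) div N)"
      using \<open>N > 0\<close> by (intro sum_mono zdiv_mono1) auto
    then show ?thesis by (simp add: W_def)
  qed
  ultimately obtain c where right: "\<And>y. y > c \<Longrightarrow> W y > W c" and left: "\<And>y. y < c \<Longrightarrow> W y < W c"
    using renewal_time_exists[of N "s + 1" W] \<open>N > 0\<close> N by auto
  \<comment> \<open>A rise of \<open>W\<close> means that the quotients grow by less than
    \<open>y - x\<close> in total; none decreases, and each index in \<open>S\<close> contributes at
    least 1.\<close>
  have count: "int (card S) < y - x"
    if "S \<subseteq> A" "W x < W y" "x \<le> y"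
      and inc: "\<And>i. i \<in> S \<Longrightarrow> (x - a i) div N + 1 \<le> (y - a i) div N" for S x y
  proof -
    have "(\<Sum>i\<in>A. (x - a i) div N + (if i \<in> S then 1 else 0)) \<le> (\<Sum>i\<in>A. (y - a i) div N)"
      using inc \<open>x \<le> y\<close> \<open>N > 0\<close> by (intro sum_mono) (auto intro: zdiv_mono1)
    moreover have "(\<Sum>i\<in>A. if i \<in> S then 1 else 0) = int (card S)"
      using \<open>finite A\<close> \<open>S \<subseteq> A\<close> by (simp add: sum.If_cases Int_absorb1)
    ultimately show ?thesis using \<open>W x < W y\<close> by (simp add: W_def sum.distrib)
  qed
  define b where "b = c - s"
  define d where "d i = (a i - b) mod N" for i
  define q where "q i = (a i - b) div N" for i
  have a: "a i = b + d i + N * q i" for i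
    using div_mult_mod_eq[of "a i - b" N] by (simp add: d_def q_def algebra_simps)
  have d: "0 \<le> d i" "d i < N" for i using \<open>N > 0\<close> by (auto simp: d_def)
  have div_a: "(b + t - a i) div N = (t - d i) div N - q i" for t i
  proof -
    have "b + t - a i = (t - d i) + N * (- q i)" by (simp add: a)
    then show ?thesis using \<open>N > 0\<close> by (metis add.commute div_mult_self2 less_irrefl uminus_add_conv_diff)
  qed
  \<comment> \<open>Relative to \<open>b\<close>, the target occupies offsets
    \<open>{0..<s}\<close>. A start at offset \<open>d i > s\<close> wraps around and covers a
    prefix of length \<open>d i + s - N = d i - s - 1\<close>; a start at \<open>d i \<le> s\<close>
    covers a suffix of length \<open>s - d i\<close>. Lengths may be 0 a priori, but the case
    \<open>k = 0\<close> of the counts below excludes this.\<close>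
  define P where "P = {i \<in> A. d i > s}"
  define Q where "Q = {i \<in> A. d i \<le> s}"
  have PQ: "finite P" "finite Q" "P \<inter> Q = {}" "P \<union> Q = A"
    using \<open>finite A\<close> by (auto simp: P_def Q_def)
  have cardPQ: "s = int (card P + card Q)" using card_Un_disjoint[of P Q] PQ s by simp
  have prefixes: "int (card {i \<in> P. d i - s - 1 \<le> k}) \<le> k" if "k \<ge> 0" for k
  proof -
    \<comment> \<open>These intervals start after time \<open>c\<close> and no later than
      \<open>c + k + 1\<close>, so the rise of \<open>W\<close> after \<open>c\<close> bounds their
      number.\<close>
    have "int (card {i \<in> P. d i - s - 1 \<le> k}) < (b + (s + k + 1)) - (b + s)"
    proof (rule count)
      fix i assume i: "i \<in> {i \<in> P. d i - s - 1 \<le> k}"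
      have "(s - d i) div N < 0" using i \<open>N > 0\<close> by (simp add: P_def pos_imp_zdiv_neg_iff)
      moreover have "(s + k + 1 - d i) div N \<ge> 0" using i \<open>N > 0\<close> by (simp add: pos_imp_zdiv_nonneg_iff)
      ultimately show "(b + s - a i) div N + 1 \<le> (b + (s + k + 1) - a i) div N"
        unfolding div_a by linarith
    qed (use that right b_def in \<open>auto simp: P_def\<close>)
    then show ?thesis by simp
  qed
  have suffixes: "int (card {i \<in> Q. s - d i \<le> k}) \<le> k" if "k \<ge> 0" for k
  proof -
    \<comment> \<open>These intervals start after time \<open>c - k - 1\<close> and no later than
      \<open>c\<close>; here the rise up to \<open>c\<close> is used.\<close>
    have "int (card {i \<in> Q. s - d i \<le> k}) < (b + s) - (b + (s - k - 1))"
    proof (rule count)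
      fix i assume i: "i \<in> {i \<in> Q. s - d i \<le> k}"
      have "(s - k - 1 - d i) div N < 0" using i \<open>N > 0\<close> by (simp add: pos_imp_zdiv_neg_iff)
      moreover have "(s - d i) div N \<ge> 0" using i \<open>N > 0\<close> by (simp add: Q_def pos_imp_zdiv_nonneg_iff)
      ultimately show "(b + (s - k - 1) - a i) div N + 1 \<le> (b + s - a i) div N"
        unfolding div_a by linarith
    qed (use that left b_def in \<open>auto simp: Q_def\<close>)
    then show ?thesis by simp
  qed
  obtain x where x: "inj_on x A" "x ` A \<subseteq> {0..<s}"
      "\<And>i. i \<in> P \<Longrightarrow> x i < d i - s - 1" "\<And>i. i \<in> Q \<Longrightarrow> s - (s - d i) \<le> x i"
    using prefix_suffix_matching[OF PQ(1-3) cardPQ prefixes suffixes] unfolding PQ(4) by blast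
  show thesis
  proof (rule that[of "\<lambda>i. b + x i" b])
    show "inj_on (\<lambda>i. b + x i) A" using x(1) by (simp add: inj_on_def)
    show "(\<lambda>i. b + x i) ` A \<subseteq> {b..<b + s}" using x(2) by auto
    fix i assume "i \<in> A"
    then have xi: "0 \<le> x i" "x i < s" using x(2) by auto
    show "\<exists>z\<in>{a i..<a i + s}. (b + x i) mod N = z mod N"
    proof (cases "i \<in> P")
      case True
      \<comment> \<open>A prefix is reached only after wrapping, hence one period more than for a
        suffix.\<close>
      have "(b + x i) mod N = (b + x i + N * (q i + 1)) mod N" by simp
      moreover have "b + x i + N * (q i + 1) \<in> {a i..<a i + s}"
        using x(3)[OF True] d(2)[of i] xi N by (simp add: a algebra_simps)
      ultimately show ?thesis by blast
    next
      case False
      then have "i \<in> Q" using \<open>i \<in> A\<close> PQ by auto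
      have "(b + x i) mod N = (b + x i + N * q i) mod N" by simp
      moreover have "b + x i + N * q i \<in> {a i..<a i + s}"
        using x(4)[OF \<open>i \<in> Q\<close>] d(1)[of i] xi by (simp add: a)
      ultimately show ?thesis by blast
    qed
  qed
qed

section \<open>Independent sets of odd cycles\<close>

lemma independent_set_subset:
  assumes "independent_set G S" "T \<subseteq> S"
  shows "independent_set G T"
  using assms unfolding independent_set_def by (meson order_trans)

text \<open>Integer arguments let intervals start anywhere without reduction; consecutive arguments
  give vertices two steps apart.\<close>

definition doubled_vertex :: "nat \<Rightarrow> int \<Rightarrow> nat" where
  "doubled_vertex s z = nat (2 * z mod (2 * int s + 1))"

lemma int_doubled_vertex: "int (doubled_vertex s z) = 2 * z mod (2 * int s + 1)"
  by (simp add: doubled_vertex_def)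

lemma doubled_vertex_mod_cong:
  assumes "z mod (2 * int s + 1) = w mod (2 * int s + 1)"
  shows "doubled_vertex s z = doubled_vertex s w"
  using assms unfolding doubled_vertex_def by (metis mod_mult_cong)

text \<open>Modulo \<open>2 * s + 1\<close> the inverse of 2 is \<open>- s\<close>. The case
  \<open>e = 0\<close> serves injectivity, \<open>e = 1\<close> adjacency.\<close>

lemma double_mod_eq_imp_dvd:
  fixes z w :: int
  assumes "2 * z mod (2 * s + 1) = (2 * w + e) mod (2 * s + 1)"
  shows "2 * s + 1 dvd z - w + e * s"
proof -
  have "2 * s + 1 dvd 2 * z - (2 * w + e)" using assms by (simp add: mod_eq_dvd_iff)
  moreover have "z - w + e * s = (2 * s + 1) * (z - w) - s * (2 * z - (2 * w + e))"
    by (simp add: algebra_simps)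
  ultimately show ?thesis by (metis dvd_diff dvd_mult dvd_triv_left)
qed

lemma inj_on_doubled_vertex: "inj_on (doubled_vertex s) {b..<b + int s}"
proof (rule inj_onI)
  fix z w assume zw: "z \<in> {b..<b + int s}" "w \<in> {b..<b + int s}"
    and "doubled_vertex s z = doubled_vertex s w"
  then have "2 * z mod (2 * int s + 1) = (2 * w + 0) mod (2 * int s + 1)"
    by (metis add.right_neutral int_doubled_vertex)
  then have "2 * int s + 1 dvd z - w" using double_mod_eq_imp_dvd[of z "int s" w 0] by simp
  moreover have "\<bar>z - w\<bar> < 2 * int s + 1" using zw by auto
  ultimately show "z = w" using zdvd_not_zless[of "\<bar>z - w\<bar>" "2 * int s + 1"] by fastforce
qed

text \<open>Adjacency would make \<open>z - w + s\<close> divisible by \<open>2 * s + 1\<close>, but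
  inside the interval this number lies strictly between 0 and \<open>2 * s\<close>.\<close>

lemma independent_doubled_interval:
  "independent_set (cycle_graph (2 * s + 1)) (doubled_vertex s ` {b..<b + int s})"
proof -
  let ?N = "2 * int s + 1"
  have "\<not> {i, Suc i mod (2 * s + 1)} \<subseteq> doubled_vertex s ` {b..<b + int s}" for i
  proof
    assume "{i, Suc i mod (2 * s + 1)} \<subseteq> doubled_vertex s ` {b..<b + int s}"
    then obtain w z where wz: "w \<in> {b..<b + int s}" "z \<in> {b..<b + int s}"
      and w: "i = doubled_vertex s w" and z: "Suc i mod (2 * s + 1) = doubled_vertex s z"
      by auto
    have "2 * z mod ?N = int (Suc i mod (2 * s + 1))"
      unfolding z by (simp add: int_doubled_vertex)
    also have "\<dots> = (2 * w mod ?N + 1) mod ?N"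
      by (simp add: w zmod_int int_doubled_vertex add.commute)
    finally have "2 * z mod ?N = (2 * w + 1) mod ?N" by (simp add: mod_add_left_eq)
    then have "?N dvd z - w + int s" using double_mod_eq_imp_dvd[of z "int s" w 1] by simp
    then show False using wz zdvd_not_zless[of "z - w + int s" ?N] by (simp; linarith)
  qed
  moreover have "doubled_vertex s z < 2 * s + 1" for z
  proof -
    have "int (doubled_vertex s z) < int (2 * s + 1)"
      using pos_mod_bound[of "2 * int s + 1" "2 * z"] by (simp add: int_doubled_vertex)
    then show ?thesis by linarith
  qed
  ultimately show ?thesis
    unfolding independent_set_def cycle_graph_def by (force simp del: insert_subset)
qed

text \<open>\<open>I\<close> and its set of successors are disjoint of size \<open>s\<close>, so
  they miss a single vertex \<open>u\<close>. Starting at \<open>u\<close>, non-membership and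
  membership alternate, which puts \<open>u + 1\<close>, \<open>u + 3\<close>, ...,
  \<open>u + 2 * s - 1\<close> into \<open>I\<close>.\<close>

lemma independent_contains_doubled_interval:
  assumes ind: "independent_set (cycle_graph (2 * s + 1)) I" and card: "card I = s"
  obtains a where "doubled_vertex s ` {a..<a + int s} \<subseteq> I"
proof -
  let ?n = "2 * s + 1"
  let ?next = "\<lambda>i. Suc i mod ?n"
  have sub: "I \<subseteq> {..<?n}" and edge: "\<And>i. i < ?n \<Longrightarrow> i \<in> I \<Longrightarrow> ?next i \<notin> I"
    using ind by (auto simp: independent_set_def cycle_graph_def)
  have fin: "finite I" using sub finite_subset by blast
  have inj: "inj_on ?next {..<?n}"
    by (auto simp: inj_on_def mod_Suc split: if_splits)
  have "card (?next ` I) = s" using card_image inj_on_subset[OF inj sub] card by blast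
  moreover have "I \<inter> ?next ` I = {}" using edge sub by blast
  ultimately have "card (I \<union> ?next ` I) = 2 * s"
    using card_Un_disjoint[of I "?next ` I"] fin card by simp
  moreover have "I \<union> ?next ` I \<subseteq> {..<?n}" using sub by auto
  ultimately have "card ({..<?n} - (I \<union> ?next ` I)) = 1"
    using card_Diff_subset[of "I \<union> ?next ` I" "{..<?n}"] fin by simp
  then obtain u where u: "{..<?n} - (I \<union> ?next ` I) = {u}" by (auto simp: card_1_singleton_iff)
  \<comment> \<open>Membership in \<open>I\<close> alternates along the cycle except at the step leading to \<open>u\<close>.\<close>
  have alternate: "?next v \<in> I" if "v < ?n" "v \<notin> I" "?next v \<noteq> u" for v
  proof (rule ccontr)
    assume "?next v \<notin> I"
    moreover have "?next v < ?n" by simp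
    ultimately have "?next v \<in> ?next ` I" using that(3) u by blast
    then obtain w where w: "w \<in> I" "?next v = ?next w" by blast
    then have "v = w" using inj_onD[OF inj w(2)] sub that(1) by blast
    then show False using w(1) that(2) by simp
  qed
  have uN: "u < ?n" "u \<notin> I" using u by auto
  \<comment> \<open>The walk does not return to \<open>u\<close> within one turn, so
    \<open>alternate\<close> stays applicable.\<close>
  have ne: "(u + t) mod ?n \<noteq> u" if "0 < t" "t < ?n" for t
  proof (cases "u + t < ?n")
    case False
    then have "(u + t) mod ?n = u + t - ?n" using uN that by (simp add: le_mod_geq)
    then show ?thesis using uN that False by linarith
  qed (use that in simp)
  have walk: "(u + 2 * j) mod ?n \<notin> I \<and> (j < s \<longrightarrow> (u + 2 * j + 1) mod ?n \<in> I)" if "j \<le> s" for j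
    using that
  proof (induction j)
    case 0
    then show ?case using uN alternate[of u] ne[of 1] by auto
  next
    case (Suc j)
    then have "(u + 2 * j + 1) mod ?n \<in> I" by simp
    then have out: "(u + 2 * Suc j) mod ?n \<notin> I"
      using edge[of "(u + 2 * j + 1) mod ?n"] by (simp add: mod_Suc_eq)
    moreover have "(u + 2 * Suc j + 1) mod ?n \<in> I" if "Suc j < s"
      using alternate[of "(u + 2 * Suc j) mod ?n"] out ne[of "2 * Suc j + 1"] that
      by (simp add: mod_Suc_eq)
    ultimately show ?case by blast
  qed
  \<comment> \<open>This halves \<open>u + 1\<close> modulo \<open>2 * s + 1\<close>, since
    \<open>2 * (s + 1)\<close> is congruent to 1.\<close>
  define a where "a = (int u + 1) * (int s + 1)"
  have "doubled_vertex s z \<in> I" if "z \<in> {a..<a + int s}" for z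
  proof -
    define j where "j = nat (z - a)"
    have j: "z = a + int j" "j < s" using that by (auto simp: j_def)
    have "2 * z = int (u + 2 * j + 1) + (2 * int s + 1) * (int u + 1)"
      by (simp add: j a_def algebra_simps)
    then have "2 * z mod (2 * int s + 1) = int (u + 2 * j + 1) mod (2 * int s + 1)"
      by (metis mod_mult_self2)
    also have "\<dots> = int ((u + 2 * j + 1) mod ?n)"
      by (simp add: zmod_int add.commute)
    finally have "doubled_vertex s z = (u + 2 * j + 1) mod ?n"
      unfolding doubled_vertex_def by (metis nat_int)
    then show ?thesis using walk[of j] j by simp
  qed
  then show thesis using that by blast
qed

section \<open>Rainbow independent sets in odd cycles and the rainbow number\<close>

lemma odd_cycle_rainbow_selection:
  assumes "independent_family (cycle_graph (2 * s + 1)) s s I"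
  obtains x where "\<And>i. i \<in> {1..s} \<Longrightarrow> x i \<in> I i" "inj_on x {1..s}"
    "independent_set (cycle_graph (2 * s + 1)) (x ` {1..s})"
proof -
  have "\<exists>a. doubled_vertex s ` {a..<a + int s} \<subseteq> I i" if "i \<in> {1..s}" for i
    using assms that independent_contains_doubled_interval[of s "I i"]
    unfolding independent_family_def by metis
  then obtain a where a: "\<And>i. i \<in> {1..s} \<Longrightarrow> doubled_vertex s ` {a i..<a i + int s} \<subseteq> I i"
    by metis
  obtain b y where y: "inj_on y {1..s}" "y ` {1..s} \<subseteq> {b..<b + int s}"
    "\<And>i. i \<in> {1..s} \<Longrightarrow> \<exists>z\<in>{a i..<a i + int s}. y i mod (2 * int s + 1) = z mod (2 * int s + 1)"
    using cyclic_intervals_matching[of "{1..s}" "int s" "2 * int s + 1" a]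
    by (metis card_atLeastAtMost diff_Suc_1 finite_atLeastAtMost)
  show thesis
  proof (rule that[of "doubled_vertex s \<circ> y"])
    fix i assume i: "i \<in> {1..s}"
    then obtain z where z: "z \<in> {a i..<a i + int s}"
      "y i mod (2 * int s + 1) = z mod (2 * int s + 1)" using y(3) by blast
    have "doubled_vertex s (y i) = doubled_vertex s z" using z(2) by (rule doubled_vertex_mod_cong)
    then show "(doubled_vertex s \<circ> y) i \<in> I i" using a[OF i] z(1) by auto
  next
    show "inj_on (doubled_vertex s \<circ> y) {1..s}"
      using y(1,2) inj_on_doubled_vertex by (blast intro: comp_inj_on inj_on_subset)
    have "(doubled_vertex s \<circ> y) ` {1..s} \<subseteq> doubled_vertex s ` {b..<b + int s}"
      using y(2) by auto
    then show "independent_set (cycle_graph (2 * s + 1)) ((doubled_vertex s \<circ> y) ` {1..s})"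
      using independent_set_subset[OF independent_doubled_interval] by blast
  qed
qed

lemma card_rainbow_set_le:
  assumes "rainbow_set k F R"
  shows "card R \<le> k"
proof -
  obtain J x where J: "J \<subseteq> {1..k}" and R: "R = x ` J"
    using assms by (auto simp: rainbow_set_def)
  have "finite J" using J finite_subset by blast
  then have "card R \<le> card J" unfolding R by (rule card_image_le)
  also have "\<dots> \<le> card {1..k}" using J by (intro card_mono) auto
  finally show ?thesis by simp
qed

theorem theorem1:
  fixes s :: nat
  assumes "s \<ge> 1"
  shows "(\<forall>I. independent_family (cycle_graph (2 * s + 1)) s s I \<longrightarrow>
            (\<exists>R. rainbow_set s I R \<and> independent_set (cycle_graph (2 * s + 1)) R \<and> card R = s) \<and>
            (\<exists>x. (\<forall>i\<in>{1..s}. x i \<in> I i) \<and> inj_on x {1..s} \<and>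
                 independent_set (cycle_graph (2 * s + 1)) (x ` {1..s}))) \<and>
         rainbow_number (cycle_graph (2 * s + 1)) s s = enat s"
proof -
  let ?G = "cycle_graph (2 * s + 1)"
  have sel: "\<exists>x. (\<forall>i\<in>{1..s}. x i \<in> I i) \<and> inj_on x {1..s} \<and> independent_set ?G (x ` {1..s})"
    if "independent_family ?G s s I" for I
    using odd_cycle_rainbow_selection[OF that] by metis
  have rainbow: "\<exists>R. rainbow_set s I R \<and> independent_set ?G R \<and> card R = s"
    if fam: "independent_family ?G s s I" for I
  proof -
    obtain x where x: "\<forall>i\<in>{1..s}. x i \<in> I i" "inj_on x {1..s}" "independent_set ?G (x ` {1..s})"
      using sel[OF fam] by blast
    have "rainbow_set s I (x ` {1..s})" using x(1,2) unfolding rainbow_set_def by blast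
    then show ?thesis using x(2,3) card_image[OF x(2)] by auto
  qed
  have lower: "s \<le> k"
    if k: "\<forall>F. independent_family ?G s k F \<longrightarrow>
             (\<exists>R. rainbow_set k F R \<and> independent_set ?G R \<and> card R = s)" for k
  proof -
    \<comment> \<open>An actual independent \<open>s\<close>-set is needed here, since otherwise the
      property of \<open>k\<close> could hold vacuously. Its constant family has only rainbow sets
      of size at most \<open>k\<close>.\<close>
    let ?S = "doubled_vertex s ` {0..<0 + int s}"
    have "card ?S = s" using card_image[OF inj_on_doubled_vertex[of s 0]] by simp
    then have "independent_family ?G s k (\<lambda>_. ?S)"
      using independent_doubled_interval[of s 0] by (simp add: independent_family_def)
    then obtain R where "rainbow_set k (\<lambda>_. ?S) R" "card R = s" using k by blast
    then show ?thesis using card_rainbow_set_le by blast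
  qed
  have "rainbow_number ?G s s = enat s"
    unfolding rainbow_number_def
  proof (rule antisym)
    show "Inf (enat ` {k. \<forall>F. independent_family ?G s k F \<longrightarrow>
            (\<exists>R. rainbow_set k F R \<and> independent_set ?G R \<and> card R = s)}) \<le> enat s"
      using rainbow by (intro Inf_lower) auto
    show "enat s \<le> Inf (enat ` {k. \<forall>F. independent_family ?G s k F \<longrightarrow>
            (\<exists>R. rainbow_set k F R \<and> independent_set ?G R \<and> card R = s)})"
      using lower by (intro Inf_greatest) auto
  qed
  then show ?thesis using sel rainbow by blast
qed

end
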